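(* Let $a,b>0$ be real numbers with $ab\neq 1$, let $k\in\mathbb{Z}$ and let $n\ge 0$ be an integer. Then for every real $x$, $$B^{(k)}_n(x;a,b)=\sum_{m=0}^{n}\frac{1}{(m+1)^k}\sum_{j=0}^{m}(-1)^j\binom{m}{j}\bigl(x-j\ln a-(j+1)\ln b\bigr)^n .$$
   Context: For $k\in\mathbb{Z}$, ${\rm Li}_k(z)=\sum_{m=1}^{\infty} z^m/m^k$ (for $|z|<1$, or as a formal power series). For $a,b>0$ with $ab\ne 1$ and real $x$, the generalized poly-Bernoulli polynomials with parameters $a,b$, denoted $B^{(k)}_n(x;a,b)$, are defined by the power series expansion around $t=0$ $$\frac{{\rm Li}_k(1-(ab)^{-t})}{b^t-a^{-t}}\,e^{xt}=\sum_{n=0}^{\infty}B^{(k)}_n(x;a,b)\frac{t^n}{n!}.$$ The singularity at $t=0$ on the left is removable. Convention: $0^0=1$. *)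

theory Defs
  imports "HOL-Complex_Analysis.Complex_Analysis" "HOL-Real_Asymp.Real_Asymp"
begin

text \<open>Only used for arguments of absolute value less than 1, where the series converges.\<close>

definition polylog :: "int \<Rightarrow> real \<Rightarrow> real" where
  "polylog k z = (\<Sum>m. z ^ Suc m / real (Suc m) powi k)"

definition poly_bernoulli_gf :: "int \<Rightarrow> real \<Rightarrow> real \<Rightarrow> real \<Rightarrow> real \<Rightarrow> real" where
  "poly_bernoulli_gf k x a b t =
     polylog k (1 - (a * b) powr (-t)) / (b powr t - a powr (-t)) * exp (x * t)"

text \<open>
  The filter \<^term>\<open>at 0\<close> excludes the removable singularity \<open>t = 0\<close>, where the quotient above
  evaluates to the junk value \<open>0 / 0 = 0\<close>.
\<close>

definition poly_bernoulli :: "int \<Rightarrow> nat \<Rightarrow> real \<Rightarrow> real \<Rightarrow> real \<Rightarrow> real" where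
  "poly_bernoulli k n x a b =
     (THE B :: nat \<Rightarrow> real. \<forall>\<^sub>F t in at 0.
        (\<lambda>i. B i * t ^ i / fact i) sums poly_bernoulli_gf k x a b t) n"

lemma exp_gen_coeffs_unique:
  fixes A B :: "nat \<Rightarrow> real" and f :: "real \<Rightarrow> real"
  assumes A: "\<forall>\<^sub>F t in at 0. (\<lambda>n. A n * t ^ n / fact n) sums f t"
      and B: "\<forall>\<^sub>F t in at 0. (\<lambda>n. B n * t ^ n / fact n) sums f t"
  shows "A = B"
proof (rule ccontr)
  assume "A \<noteq> B"
  define D where "D = (\<lambda>n. (A n - B n) / fact n)"
  from \<open>A \<noteq> B\<close> obtain m where m: "D m \<noteq> 0"
    unfolding D_def by fastforce
  have "\<forall>\<^sub>F t in at 0. (\<lambda>n. D n * t ^ n) sums 0"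
    using A B
  proof eventually_elim
    case (elim t)
    from sums_diff[OF this] show ?case
      by (simp add: D_def diff_divide_distrib algebra_simps)
  qed
  then obtain r where r: "r > 0" "\<And>t. t \<noteq> 0 \<Longrightarrow> \<bar>t\<bar> < r \<Longrightarrow> (\<lambda>n. D n * t ^ n) sums 0"
    unfolding eventually_at by (auto simp: dist_norm)
  define g :: "real \<Rightarrow> real" where "g = (\<lambda>t. if t = 0 then D 0 else 0)"
  have g: "(\<lambda>n. D n * t ^ n) sums g t" if "norm t < r" for t
    using r(2)[of t] that powser_sums_zero[of D] by (cases "t = 0") (auto simp: g_def)
  have "continuous (at 0) (\<lambda>t. \<Sum>n. D n * t ^ n)"
    using r(2)[of "r / 2"] r(1) by (intro isCont_powser[of _ "r / 2"]) (auto simp: sums_iff)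
  then have "((\<lambda>t. \<Sum>n. D n * t ^ n) \<longlongrightarrow> D 0) (at 0)"
    by (simp add: isCont_def)
  moreover have "((\<lambda>t. \<Sum>n. D n * t ^ n) \<longlongrightarrow> 0) (at 0)"
  proof (rule tendsto_eventually)
    show "\<forall>\<^sub>F t in at 0. (\<Sum>n. D n * t ^ n) = 0"
      unfolding eventually_at using r by (auto intro!: exI[of _ r] simp: dist_norm sums_iff)
  qed
  ultimately have D0: "D 0 = 0"
    by (intro tendsto_unique[of "at (0::real)"]) auto
  with m have "m > 0" by (cases m) auto
  have "g 0 = 0" using D0 by (simp add: g_def)
  obtain s where s: "s > 0" "\<And>z. z \<in> cball 0 s - {0} \<Longrightarrow> g z \<noteq> 0"
    using powser_0_nonzero[of r 0 D g m] r(1) g \<open>g 0 = 0\<close> m \<open>m > 0\<close> by auto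
  from s(2)[of s] s(1) show False by (auto simp: g_def)
qed

lemma poly_bernoulli_expansion_exists:
  fixes a b x :: real and k :: int
  assumes a: "a > 0" and b: "b > 0" and ab: "a * b \<noteq> 1"
  shows "\<exists>B. \<forall>\<^sub>F t in at 0. (\<lambda>n. B n * t ^ n / fact n) sums poly_bernoulli_gf k x a b t"
proof -
  define c where "c = ln (a * b)"
  have c: "c \<noteq> 0" using a b ab by (simp add: c_def)
  define l where "l = (\<lambda>m. 1 / (real (Suc m) powi k))"
  have lim: "(\<lambda>n. norm (l n) / norm (l (Suc n))) \<longlonglongrightarrow> 1"
  proof -
    have "(\<lambda>n. (real (Suc (Suc n)) / real (Suc n)) powi k) \<longlonglongrightarrow> 1 powi k"
      by (intro tendsto_power_int) (real_asymp, simp)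
    then show ?thesis
      by (simp add: l_def power_int_divide_distrib norm_power_int power_int_abs[symmetric]
          del: of_nat_Suc)
  qed
  define F where "F = Abs_fps (\<lambda>n. complex_of_real (l n))"
  have l0: "l n \<noteq> 0" for n by (simp add: l_def del: of_nat_Suc)
  have "fps_conv_radius F = ereal 1"
    unfolding fps_conv_radius_def F_def
    using lim l0 by (intro conv_radius_ratio_limit_ereal) auto
  then have F: "eval_fps F has_fps_expansion F" by (simp add: eval_fps_has_fps_expansion)
  have Feval: "eval_fps F (of_real z) * of_real z = of_real (polylog k z)" if "\<bar>z\<bar> < 1" for z
  proof -
    have "(\<lambda>n. fps_nth F n * of_real z ^ n) sums eval_fps F (of_real z)"
      by (rule sums_eval_fps) (use \<open>fps_conv_radius F = ereal 1\<close> that in simp)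
    from sums_mult2[OF this, of "of_real z"]
    have *: "(\<lambda>n. complex_of_real (z ^ Suc n / real (Suc n) powi k)) sums
               (eval_fps F (of_real z) * of_real z)"
      by (simp add: F_def l_def mult_ac del: of_nat_Suc)
    have "(\<lambda>n. z ^ Suc n / real (Suc n) powi k) sums Re (eval_fps F (of_real z) * of_real z)"
      using sums_Re[OF *] by (simp only: Re_complex_of_real)
    then have "summable (\<lambda>n. z ^ Suc n / real (Suc n) powi k)" by (rule sums_summable)
    then have "(\<lambda>n. z ^ Suc n / real (Suc n) powi k) sums polylog k z"
      unfolding polylog_def by (rule summable_sums)
    then have "(\<lambda>n. complex_of_real (z ^ Suc n / real (Suc n) powi k)) sums of_real (polylog k z)"
      by (rule sums_of_real)
    with * show ?thesis using sums_unique2 by blast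
  qed
  define G where "G = 1 - fps_exp (- complex_of_real c)"
  have G: "(\<lambda>w. 1 - exp (- complex_of_real c * w)) has_fps_expansion G"
    unfolding G_def by (intro fps_expansion_intros)
  have "(eval_fps F \<circ> (\<lambda>w. 1 - exp (- complex_of_real c * w))) has_fps_expansion (F oo G)"
    by (rule has_fps_expansion_compose[OF F G]) (simp add: G_def)
  then have H: "(\<lambda>w. (eval_fps F \<circ> (\<lambda>w. 1 - exp (- complex_of_real c * w))) w *
                  exp (of_real (x - ln b) * w)) has_fps_expansion
             ((F oo G) * fps_exp (of_real (x - ln b)))" (is "?h has_fps_expansion ?H")
    by (intro has_fps_expansion_mult has_fps_expansion_exp)
  have ev1: "\<forall>\<^sub>F w in nhds 0. eval_fps ?H w = ?h w" and rad: "fps_conv_radius ?H > 0"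
    using H by (auto simp: has_fps_expansion_def)
  have "\<forall>\<^sub>F w in nhds 0. w \<in> eball 0 (fps_conv_radius ?H)"
    using rad by (intro eventually_nhds_in_open) (auto simp: zero_ereal_def)
  with ev1 have "\<forall>\<^sub>F w in nhds 0. (\<lambda>n. fps_nth ?H n * w ^ n) sums ?h w"
  proof eventually_elim
    case (elim w)
    then have "norm w < fps_conv_radius ?H" by (simp add: in_eball_iff)
    from sums_eval_fps[OF this] elim(1) show ?case by metis
  qed
  moreover have "filterlim complex_of_real (nhds 0) (at 0)"
    by (intro tendsto_eq_intros) auto
  ultimately have ev: "\<forall>\<^sub>F t in at 0. (\<lambda>n. fps_nth ?H n * of_real t ^ n) sums ?h (of_real t)"
    unfolding filterlim_iff by blast
  have "((\<lambda>t. 1 - exp (- c * t)) \<longlongrightarrow> 1 - exp (- c * 0)) (at 0)"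
    by (intro tendsto_intros)
  then have "\<forall>\<^sub>F t in at 0. dist (1 - exp (- c * t)) (1 - exp (- c * 0)) < 1"
    by (rule tendstoD) simp
  then have ev2: "\<forall>\<^sub>F t in at 0. \<bar>1 - exp (- c * t)\<bar> < 1" by (simp add: dist_norm)
  have ev3: "\<forall>\<^sub>F t in at 0. t \<noteq> (0 :: real)" by (rule eventually_neq_at_within)
  have "\<forall>\<^sub>F t in at 0. (\<lambda>n. (fact n * Re (fps_nth ?H n)) * t ^ n / fact n) sums
          poly_bernoulli_gf k x a b t"
    using ev ev2 ev3
  proof eventually_elim
    case (elim t)
    define z where "z = 1 - exp (- c * t)"
    have z: "z \<noteq> 0" "\<bar>z\<bar> < 1" using elim c by (auto simp: z_def)
    have e1: "1 - (a * b) powr (- t) = z"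
      using a b by (simp add: z_def c_def powr_def mult_ac)
    have e2: "b powr t - a powr (- t) = exp (t * ln b) * z"
      using a b by (simp add: z_def c_def powr_def ln_mult algebra_simps exp_add[symmetric])
    have "of_real (poly_bernoulli_gf k x a b t) =
          (of_real (polylog k z) / of_real z * of_real (exp ((x - ln b) * t)) :: complex)"
      unfolding poly_bernoulli_gf_def e1 e2 using z
      by (simp add: left_diff_distrib right_diff_distrib exp_diff mult_ac flip: of_real_mult of_real_divide)
    also have "\<dots> = eval_fps F (of_real z) * of_real (exp ((x - ln b) * t))"
      using Feval[OF z(2)] z(1) by (simp add: divide_simps)
    also have "\<dots> = ?h (of_real t)"
      by (simp add: z_def exp_of_real[symmetric])
    finally have "(\<lambda>n. fps_nth ?H n * of_real t ^ n) sums of_real (poly_bernoulli_gf k x a b t)"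
      using elim(1) by simp
    from sums_Re[OF this] show ?case by (simp flip: of_real_power)
  qed
  then show ?thesis by (rule exI[of _ "\<lambda>n. fact n * Re (fps_nth ?H n)"])
qed

lemma poly_bernoulli_sums:
  fixes a b x :: real and k :: int
  assumes "a > 0" "b > 0" "a * b \<noteq> 1"
  shows "\<forall>\<^sub>F t in at 0.
           (\<lambda>n. poly_bernoulli k n x a b * t ^ n / fact n) sums poly_bernoulli_gf k x a b t"
proof -
  from poly_bernoulli_expansion_exists[OF assms]
  have "\<exists>!B. \<forall>\<^sub>F t in at 0. (\<lambda>n. B n * t ^ n / fact n) sums poly_bernoulli_gf k x a b t"
    using exp_gen_coeffs_unique by blast
  from theI'[OF this] show ?thesis
    by (simp add: poly_bernoulli_def)
qed

end

theory Submission
  imports Defs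
begin

text \<open>
  Put \<open>z = 1 - (a b) powr (-t)\<close>. The generating function equals
  \<open>exp ((x - ln b) t)\<close> times the power series \<open>\<Sum>m. z ^ m / (m + 1) powi k\<close>, and \<open>z\<close> vanishes to
  first order at \<open>t = 0\<close>. Hence the terms with \<open>m > n\<close> contribute \<open>O(t ^ (n + 1))\<close> and do not affect
  the \<open>n\<close>-th coefficient; expanding \<open>z ^ m\<close> binomially turns each remaining term into a combination of
  the exponentials \<open>exp ((x - j ln a - (j + 1) ln b) t)\<close>, whose coefficients are known.
\<close>

text \<open>Dividing by \<open>t ^ N\<close> shifts the series down by \<open>N\<close> places. The
  shifted series is continuous at 0, where only its constant term \<open>d N\<close>
  survives.\<close>

lemma powser_leading_coeff_tendsto:
  fixes d :: "nat \<Rightarrow> real"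
  assumes sums: "\<forall>\<^sub>F t in at 0. (\<lambda>i. d i * t ^ i) sums h t"
    and zero: "\<And>i. i < N \<Longrightarrow> d i = 0"
  shows "((\<lambda>t. h t / t ^ N) \<longlongrightarrow> d N) (at 0)"
proof -
  have ev: "\<forall>\<^sub>F t in at 0. (\<lambda>i. d (i + N) * t ^ i) sums (h t / t ^ N)"
    using sums eventually_neq_at_within[of 0 0]
  proof eventually_elim
    case (elim t)
    have "(\<lambda>i. d (i + N) * t ^ (i + N)) sums h t"
      using sums_zero_iff_shift[of N "\<lambda>i. d i * t ^ i" "h t"] zero elim(1) by simp
    from sums_divide[OF this, of "t ^ N"] elim(2) show ?case
      by (simp add: power_add)
  qed
  then obtain r where r: "r > 0"
      "\<And>t. t \<noteq> 0 \<Longrightarrow> \<bar>t\<bar> < r \<Longrightarrow> (\<lambda>i. d (i + N) * t ^ i) sums (h t / t ^ N)"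
    unfolding eventually_at by (auto simp: dist_norm)
  have "isCont (\<lambda>t. \<Sum>i. d (i + N) * t ^ i) 0"
    \<comment> \<open>The point \<open>r / 2\<close> is a nonzero point of convergence, so 0 lies
      strictly inside the disc of convergence.\<close>
    using r(2)[of "r / 2"] r(1) by (intro isCont_powser[of _ "r / 2"]) (auto simp: sums_iff)
  then have "((\<lambda>t. \<Sum>i. d (i + N) * t ^ i) \<longlongrightarrow> d N) (at 0)"
    by (simp add: isCont_def)
  moreover have "\<forall>\<^sub>F t in at 0. (\<Sum>i. d (i + N) * t ^ i) = h t / t ^ N"
    using ev by eventually_elim (simp add: sums_iff)
  ultimately show ?thesis
    by (rule Lim_transform_eventually)
qed

text \<open>This turns an estimate \<open>h t\<close> = O(\<open>t ^ N\<close>) into vanishing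
  coefficients. By strong induction, once all coefficients before \<open>d i\<close> vanish,
  \<open>h t / t ^ i\<close> tends to \<open>d i\<close>; it also tends to 0, because a positive
  power \<open>t ^ (N - i)\<close> is left over.\<close>

lemma powser_coeff_eq_0:
  fixes d :: "nat \<Rightarrow> real"
  assumes sums: "\<forall>\<^sub>F t in at 0. (\<lambda>i. d i * t ^ i) sums h t"
    and lim: "((\<lambda>t. h t / t ^ N) \<longlongrightarrow> L) (at 0)"
    and "i < N"
  shows "d i = 0"
  using \<open>i < N\<close>
proof (induction i rule: less_induct)
  case (less i)
  have "((\<lambda>t. h t / t ^ i) \<longlongrightarrow> d i) (at 0)"
    using sums less by (intro powser_leading_coeff_tendsto) auto
  moreover have "((\<lambda>t. h t / t ^ i) \<longlongrightarrow> 0) (at 0)"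
  proof (rule Lim_transform_eventually)
    have "((\<lambda>t. h t / t ^ N * t ^ (N - i)) \<longlongrightarrow> L * 0 ^ (N - i)) (at 0)"
      by (intro tendsto_intros lim)
    then show "((\<lambda>t. h t / t ^ N * t ^ (N - i)) \<longlongrightarrow> 0) (at 0)"
      using less.prems by (simp add: zero_power)
    show "\<forall>\<^sub>F t in at 0. h t / t ^ N * t ^ (N - i) = h t / t ^ i"
      using eventually_neq_at_within[of 0 0]
      by eventually_elim (use less.prems in \<open>simp add: power_diff\<close>)
  qed
  ultimately show ?case
    by (intro tendsto_unique[of "at (0::real)"]) auto
qed

text \<open>For either sign of \<open>k\<close> the ratios of consecutive coefficients tend to 1, so
  the radius of convergence is 1. Division by \<open>z\<close> makes the exponents start at
  0.\<close>

lemma polylog_sums: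
  assumes "\<bar>z\<bar> < 1" "z \<noteq> 0"
  shows "(\<lambda>m. 1 / real (m + 1) powi k * z ^ m) sums (polylog k z / z)"
proof -
  define l where "l = (\<lambda>m. 1 / real (m + 1) powi k)"
  have "(\<lambda>m. norm (l m) / norm (l (Suc m))) \<longlonglongrightarrow> 1"
  proof -
    have "(\<lambda>m. (real (Suc m + 1) / real (m + 1)) powi k) \<longlonglongrightarrow> 1 powi k"
      by (intro tendsto_power_int) (real_asymp, simp)
    then show ?thesis
      by (simp add: l_def power_int_divide_distrib norm_power_int power_int_abs[symmetric])
  qed
  moreover have "l m \<noteq> 0" for m
    by (simp add: l_def)
  ultimately have "conv_radius l = ereal 1"
    by (intro conv_radius_ratio_limit_ereal) auto
  then have "summable (\<lambda>m. l m * z ^ m)"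
    using assms by (intro summable_in_conv_radius) auto
  then have "summable (\<lambda>m. z * (l m * z ^ m))"
    by (rule summable_mult)
  then have "(\<lambda>m. z * (l m * z ^ m)) sums polylog k z"
    unfolding polylog_def l_def by (simp add: summable_sums mult_ac add_ac)
  from sums_divide[OF this, of z] assms show ?thesis
    by (simp add: l_def)
qed

theorem theorem2p1:
  fixes a b x :: real and k :: int and n :: nat
  assumes "a > 0" and "b > 0" and "a * b \<noteq> 1"
  shows "poly_bernoulli k n x a b =
           (\<Sum>m=0..n. 1 / real (m + 1) powi k *
              (\<Sum>j=0..m. (-1) ^ j * real (m choose j) * (x - real j * ln a - real (j + 1) * ln b) ^ n))"
proof -
  define c where "c = ln a + ln b"
  have ln_ab: "ln (a * b) = c"
    using assms by (simp add: c_def ln_mult)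
  have "ln (a * b) \<noteq> 0"
    using assms by simp
  then have c: "c \<noteq> 0"
    by (simp add: ln_ab)
  define l where "l = (\<lambda>m. 1 / real (m + 1) powi k)"
  define y where "y = (\<lambda>j. x - real j * ln a - real (j + 1) * ln b)"
  define z where "z = (\<lambda>t. 1 - exp (- c * t))"
  \<comment> \<open>The exponent \<open>i\<close> varies while the outer sum stays cut off at
    \<open>n\<close>: these are the exponential coefficients of \<open>S\<close>, and
    \<open>C n\<close> is the claimed value.\<close>
  define C where "C = (\<lambda>i. \<Sum>m=0..n. l m * (\<Sum>j=0..m. (-1) ^ j * real (m choose j) * y j ^ i))"
  define S where "S = (\<lambda>t. \<Sum>m=0..n. l m * (\<Sum>j=0..m. (-1) ^ j * real (m choose j) * exp (y j * t)))"
  define R where "R = (\<lambda>w. polylog k w / w - (\<Sum>m=0..n. l m * w ^ m))"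

  have S_sums: "(\<lambda>i. C i / fact i * t ^ i) sums S t" for t
  proof -
    have "(\<lambda>i. y j ^ i * t ^ i / fact i) sums exp (y j * t)" for j
      using exp_converges[of "y j * t"] by (simp add: power_mult_distrib divide_inverse mult_ac)
    then have "(\<lambda>i. \<Sum>m=0..n. l m * (\<Sum>j=0..m. (-1) ^ j * real (m choose j) * (y j ^ i * t ^ i / fact i)))
                 sums S t"
      unfolding S_def by (intro sums_sum sums_mult)
    then show ?thesis
      by (simp add: C_def sum_distrib_left sum_distrib_right sum_divide_distrib mult_ac)
  qed

  have S_eq: "S t = exp ((x - ln b) * t) * (\<Sum>m=0..n. l m * z t ^ m)" for t
  proof -
    have "(\<Sum>j=0..m. (-1) ^ j * real (m choose j) * exp (y j * t)) = exp ((x - ln b) * t) * z t ^ m" for m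
    proof -
      \<comment> \<open>Since \<open>y j = (x - ln b) - j * c\<close>, the exponentials form a
        geometric progression in \<open>j\<close>, as the binomial theorem requires.\<close>
      have exp_y: "exp (y j * t) = exp ((x - ln b) * t) * exp (- c * t) ^ j" for j
        by (simp add: y_def c_def algebra_simps flip: exp_of_nat_mult exp_add)
      have "z t ^ m = (\<Sum>j\<le>m. real (m choose j) * (- exp (- c * t)) ^ j)"
        using binomial_ring[of "- exp (- c * t)" 1 m] by (simp add: z_def)
      also have "\<dots> = (\<Sum>j=0..m. (-1) ^ j * real (m choose j) * exp (- c * t) ^ j)"
        by (intro sum.cong) (auto simp: power_minus[of "exp _"])
      finally show ?thesis
        unfolding exp_y by (simp add: sum_distrib_left mult_ac)
    qed
    then have "S t = (\<Sum>m=0..n. l m * (exp ((x - ln b) * t) * z t ^ m))"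
      unfolding S_def by (simp only:)
    then show ?thesis
      by (simp add: sum_distrib_left mult_ac)
  qed

  have z_tendsto: "(z \<longlongrightarrow> 0) (at 0)"
    unfolding z_def by (auto intro!: tendsto_eq_intros)
  have z_nz: "z t \<noteq> 0" if "t \<noteq> 0" for t
    using that c by (simp add: z_def)
  \<comment> \<open>The punctured filter on the target side lets limits of
    \<open>R w / w ^ Suc n\<close> at 0 be composed with \<open>z\<close>.\<close>
  have z_at: "filterlim z (at 0) (at 0)"
    using z_tendsto z_nz by (auto simp: filterlim_at eventually_at_filter)
  have z_quot: "((\<lambda>t. z t / t) \<longlongrightarrow> c) (at 0)"
  proof -
    have "(z has_real_derivative c) (at 0)"
      unfolding z_def by (auto intro!: derivative_eq_intros)
    then show ?thesis
      by (simp add: has_field_derivative_iff z_def)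
  qed
  have small: "\<forall>\<^sub>F w in at 0. \<bar>w\<bar> < (1::real) \<and> w \<noteq> 0"
    unfolding eventually_at by (auto intro!: exI[of _ 1] simp: dist_norm)

  \<comment> \<open>The denominator factors as \<open>exp (t * ln b) * z t\<close>, which accounts
    for both the quotient by \<open>z t\<close> and the shift of \<open>x\<close> by
    \<open>ln b\<close>.\<close>
  have gf_eq: "poly_bernoulli_gf k x a b t - S t = R (z t) * exp ((x - ln b) * t)" if "t \<noteq> 0" for t
  proof -
    have "1 - (a * b) powr (- t) = z t"
      using assms by (simp add: ln_ab z_def powr_def mult_ac)
    moreover have "b powr t - a powr (- t) = exp (t * ln b) * z t"
      using assms by (simp add: z_def c_def powr_def algebra_simps flip: exp_add)
    moreover have "exp ((x - ln b) * t) = exp (x * t) / exp (t * ln b)"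
      by (simp add: algebra_simps flip: exp_diff)
    ultimately have "poly_bernoulli_gf k x a b t = polylog k (z t) / z t * exp ((x - ln b) * t)"
      by (simp add: poly_bernoulli_gf_def)
    then show ?thesis
      by (simp add: S_eq R_def algebra_simps)
  qed

  obtain L where L: "((\<lambda>w. R w / w ^ Suc n) \<longlongrightarrow> L) (at 0)"
  proof
    have "\<forall>\<^sub>F w in at 0. (\<lambda>m. (if m \<le> n then 0 else l m) * w ^ m) sums R w"
      using small
    proof eventually_elim
      case (elim w)
      have "(\<lambda>m. if m \<in> {0..n} then l m * w ^ m else 0) sums (\<Sum>m=0..n. l m * w ^ m)"
        by (intro sums_If_finite_set) auto
      moreover have "(\<lambda>m. l m * w ^ m) sums (polylog k w / w)"
        unfolding l_def using elim by (intro polylog_sums) auto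
      ultimately have "(\<lambda>m. l m * w ^ m - (if m \<in> {0..n} then l m * w ^ m else 0)) sums R w"
        unfolding R_def by (intro sums_diff)
      then show ?case
        by (rule sums_cong[THEN iffD1, rotated]) auto
    qed
    \<comment> \<open>The limit is \<open>l (Suc n)\<close>, written as the entry of the truncated
      coefficient sequence at \<open>Suc n\<close>.\<close>
    then show "((\<lambda>w. R w / w ^ Suc n) \<longlongrightarrow> (if Suc n \<le> n then 0 else l (Suc n))) (at 0)"
      by (rule powser_leading_coeff_tendsto) auto
  qed

  have "((\<lambda>t. (poly_bernoulli_gf k x a b t - S t) / t ^ Suc n)
          \<longlongrightarrow> L * c ^ Suc n * exp ((x - ln b) * 0)) (at 0)"
  proof (rule Lim_transform_eventually)
    show "((\<lambda>t. R (z t) / z t ^ Suc n * (z t / t) ^ Suc n * exp ((x - ln b) * t))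
            \<longlongrightarrow> L * c ^ Suc n * exp ((x - ln b) * 0)) (at 0)"
      by (intro tendsto_intros filterlim_compose[OF L z_at] z_quot)
    show "\<forall>\<^sub>F t in at 0. R (z t) / z t ^ Suc n * (z t / t) ^ Suc n * exp ((x - ln b) * t) =
            (poly_bernoulli_gf k x a b t - S t) / t ^ Suc n"
      using eventually_neq_at_within[of 0 0]
      by eventually_elim (simp add: gf_eq z_nz power_divide del: power_Suc)
  qed
  moreover have "\<forall>\<^sub>F t in at 0. (\<lambda>i. (poly_bernoulli k i x a b - C i) / fact i * t ^ i) sums
                   (poly_bernoulli_gf k x a b t - S t)"
    using poly_bernoulli_sums[OF assms, of k x]
  proof eventually_elim
    case (elim t)
    from sums_diff[OF this S_sums[of t]] show ?case
      by (simp add: diff_divide_distrib left_diff_distrib)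
  qed
  \<comment> \<open>Here \<open>N\<close> is \<open>Suc n\<close>, so that index \<open>n\<close>
    lies strictly below the order of vanishing.\<close>
  ultimately have "(poly_bernoulli k n x a b - C n) / fact n = 0"
    by (intro powser_coeff_eq_0) auto
  then show ?thesis
    by (simp add: C_def l_def y_def)
qed

end
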